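(* For any integer $n\ge 0$, the following hold. (1) $\mathrm{pod}_{-4}(4n+2)\equiv 0 \pmod 2$. (2) If $n=k(k+1)$ for some integer $k$, then $\mathrm{pod}_{-4}(2n+1)\equiv 4 \pmod 8$. Otherwise $\mathrm{pod}_{-4}(2n+1)\equiv 0 \pmod 8$.
   Context: For a positive integer $k$, $\mathrm{pod}_{-k}(n)$ denotes the number of partition $k$-tuples of $n$ (that is, $k$-tuples of partitions whose sizes sum to $n$) such that in each of the $k$ partitions the odd parts are distinct. Its generating function is \[\sum_{n\ge 0}\mathrm{pod}_{-k}(n)q^n=\prod_{j\ge 1}\frac{(1+q^{2j-1})^k}{(1-q^{2j})^k}=\frac{1}{\psi(-q)^k},\qquad \psi(q)=\sum_{n=0}^{\infty}q^{n(n+1)/2}.\] *)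

theory Defs
  imports "HOL-Library.Multiset" "HOL-Number_Theory.Cong"
begin

text \<open>A partition is the finite multiset of its (positive) parts; its size is \<^const>\<open>sum_mset\<close>.\<close>

definition is_partition :: "nat multiset \<Rightarrow> bool" where
  "is_partition p \<longleftrightarrow> 0 \<notin># p"

definition odd_parts_distinct :: "nat multiset \<Rightarrow> bool" where
  "odd_parts_distinct p \<longleftrightarrow> (\<forall>i. odd i \<longrightarrow> count p i \<le> 1)"

text \<open>A \<open>k\<close>-tuple is a list of length \<open>k\<close>. In \<open>pod_neg k n\<close> the subscript
  \<open>-k\<close> of the usual notation is represented by \<open>k\<close>.\<close>

definition pod_tuples :: "nat \<Rightarrow> nat \<Rightarrow> nat multiset list set" where
  "pod_tuples k n =
     {ps. length ps = k \<and> (\<forall>p\<in>set ps. is_partition p \<and> odd_parts_distinct p)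
          \<and> (\<Sum>p\<leftarrow>ps. sum_mset p) = n}"

definition pod_neg :: "nat \<Rightarrow> nat \<Rightarrow> nat" where
  "pod_neg k n = card (pod_tuples k n)"

lemma size_le_sum_mset: "is_partition p \<Longrightarrow> size p \<le> sum_mset p"
  unfolding is_partition_def by (induction p) auto

lemma finite_partitions_le: "finite {p. is_partition p \<and> sum_mset p \<le> n}"
proof (rule finite_subset)
  show "{p. is_partition p \<and> sum_mset p \<le> n}
          \<subseteq> mset ` {xs. set xs \<subseteq> {..n} \<and> length xs \<le> n}"
  proof
    fix p assume "p \<in> {p. is_partition p \<and> sum_mset p \<le> n}"
    then have p: "is_partition p" "sum_mset p \<le> n" by auto
    obtain xs where xs: "mset xs = p" by (metis ex_mset)
    have "length xs \<le> n"
      using size_le_sum_mset[OF p(1)] p(2) unfolding xs[symmetric] by simp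
    moreover have "x \<le> n" if "x \<in> set xs" for x
      using member_le_sum_list[OF that] p(2) unfolding xs[symmetric] sum_mset_sum_list by simp
    ultimately show "p \<in> mset ` {xs. set xs \<subseteq> {..n} \<and> length xs \<le> n}"
      using xs by auto
  qed
qed (simp add: finite_lists_length_le)

text \<open>Hence \<^const>\<open>card\<close> in the definition of \<^const>\<open>pod_neg\<close> is a genuine count.\<close>

lemma finite_pod_tuples: "finite (pod_tuples k n)"
proof (rule finite_subset)
  show "pod_tuples k n
          \<subseteq> {ps. set ps \<subseteq> {p. is_partition p \<and> sum_mset p \<le> n} \<and> length ps = k}"
  proof
    fix ps assume ps: "ps \<in> pod_tuples k n"
    have "sum_mset p \<le> n" if "p \<in> set ps" for p
    proof -
      have "sum_mset p \<in> set (map sum_mset ps)" using that by simp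
      from member_le_sum_list[OF this] show ?thesis
        using ps by (simp add: pod_tuples_def)
    qed
    then show "ps \<in> {ps. set ps \<subseteq> {p. is_partition p \<and> sum_mset p \<le> n} \<and> length ps = k}"
      using ps unfolding pod_tuples_def by blast
  qed
qed (simp add: finite_lists_length_eq finite_partitions_le)

end

theory Submission
  imports Defs "HOL-Computational_Algebra.Formal_Power_Series" "HOL-Library.Nat_Bijection"
begin

text \<open>
  Write \<open>\<psi>(q) = \<Sum>q\<^bsup>k(k+1)/2\<^esup>\<close>, \<open>S(q) = \<Sum>q\<^bsup>m\<^sup>2\<^esup>\<close> over \<open>m \<ge> 1\<close>,
  and \<open>F = 1 / \<psi>(-q)\<^sup>4\<close> for the generating function of \<open>pod\<^sub>-\<^sub>4\<close>.
  Since \<open>\<psi>(-q)\<close> and \<open>\<psi>(q)\<close> agree mod 2, their fourth powers agree mod 8.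
  As \<open>f(q)\<^sup>2 \<equiv> f(q\<^sup>2)\<close> mod 2 for every integral series, \<open>F \<equiv> 1 / \<psi>(q\<^sup>4)\<close> mod 2, which gives (1).

  For (2), \<open>\<psi>(q)\<^sup>2 = \<psi>(q\<^sup>2) (1 + 2 S(q))\<close> and \<open>(1 + 2 S)\<^sup>2 \<equiv> 1 + 4 S(q) + 4 S(q\<^sup>2)\<close> mod 8,
  a series that is its own inverse mod 8. Hence \<open>F \<equiv> (1 + 4 S(q) + 4 S(q\<^sup>2)) / \<psi>(q\<^sup>2)\<^sup>2\<close> mod 8.
  The odd part of \<open>S(q)\<close> is \<open>q \<psi>(q\<^sup>8)\<close>, and \<open>\<psi>(q\<^sup>8) / \<psi>(q\<^sup>2)\<^sup>2 \<equiv> \<psi>(q\<^sup>4)\<close> mod 2,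
  so the odd part of \<open>F\<close> is \<open>4 q \<psi>(q\<^sup>4)\<close> mod 8.

  That the generating function of partitions with distinct odd parts is \<open>1 / \<psi>(-q)\<close> is Gauss' identity;
  it is the limit of a finite identity of Shanks, whose two sides differ by a telescoping sum.
\<close>

unbundle fps_syntax

section \<open>Integral power series: substituting powers of X, and squares modulo 2\<close>

lemma fps_nth_compose_X_power:
  fixes f :: "'a::comm_ring_1 fps"
  assumes "k > 0"
  shows "(f oo fps_X ^ k) $ n = (if k dvd n then f $ (n div k) else 0)"
proof -
  have "(f oo fps_X ^ k) $ n = (\<Sum>i\<in>{0..n}. if n = k * i then f $ i else 0)"
    by (simp add: fps_compose_nth power_mult [symmetric] if_distrib cong: if_cong)
  also have "\<dots> = (\<Sum>i\<in>{0..n}. if i = n div k \<and> k dvd n then f $ i else 0)"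
    using assms by (intro sum.cong) auto
  also have "\<dots> = (if k dvd n then f $ (n div k) else 0)"
    by auto
  finally show ?thesis .
qed

text \<open>The reflection \<open>i -> n - i\<close> pairs off all terms except a middle one, which
  exists only for even \<open>n\<close>.\<close>

lemma sum_symmetric_pairs:
  fixes f :: "nat \<Rightarrow> 'a::comm_semiring_1"
  shows "(\<Sum>i\<le>n. f i * f (n - i)) =
           2 * (\<Sum>i | 2 * i < n. f i * f (n - i)) + (if even n then f (n div 2) ^ 2 else 0)"
proof -
  have fin: "finite {i. 2 * i < n}" "finite {i. i \<le> n \<and> n < 2 * i}" "finite {i. 2 * i = n}"
    by (auto intro: finite_subset [of _ "{..n}"])
  have "{..n} = {i. 2 * i < n} \<union> {i. i \<le> n \<and> n < 2 * i} \<union> {i. 2 * i = n}"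
    by auto
  then have "(\<Sum>i\<le>n. f i * f (n - i)) = (\<Sum>i | 2 * i < n. f i * f (n - i)) +
       (\<Sum>i | i \<le> n \<and> n < 2 * i. f i * f (n - i)) + (\<Sum>i | 2 * i = n. f i * f (n - i))"
    using fin by (simp only:) (subst sum.union_disjoint; auto)+
  also have "(\<Sum>i | i \<le> n \<and> n < 2 * i. f i * f (n - i)) = (\<Sum>i | 2 * i < n. f i * f (n - i))"
    by (rule sum.reindex_bij_witness [of _ "\<lambda>i. n - i" "\<lambda>i. n - i"]) (auto simp: mult.commute)
  also have "(\<Sum>i | 2 * i = n. f i * f (n - i)) = (if even n then f (n div 2) ^ 2 else 0)"
  proof (cases "even n")
    case True
    then have "{i. 2 * i = n} = {n div 2}" by auto
    moreover have "n - n div 2 = n div 2" using True by auto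
    ultimately show ?thesis using True by (simp add: power2_eq_square)
  next
    case False
    then have "{i. 2 * i = n} = {}" by auto
    with False show ?thesis by simp
  qed
  finally show ?thesis by (simp add: mult_2)
qed

text \<open>Lets a congruence be an equation in the ring of series with an explicit cofactor, and
  still be read off coefficientwise.\<close>

lemma numeral_dvd_fps_iff:
  fixes f :: "int fps"
  shows "numeral k dvd f \<longleftrightarrow> (\<forall>n. numeral k dvd f $ n)"
proof
  assume "numeral k dvd f"
  then obtain g where "f = numeral k * g" ..
  then show "\<forall>n. numeral k dvd f $ n" by (simp add: numeral_fps_const)
next
  assume *: "\<forall>n. numeral k dvd f $ n"
  have "f = numeral k * Abs_fps (\<lambda>n. f $ n div numeral k)"
    using * by (simp add: fps_eq_iff numeral_fps_const)
  then show "numeral k dvd f" ..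
qed

text \<open>Off-diagonal products occur twice in a coefficient of \<open>f\<^sup>2\<close>, and the
  middle one is \<open>x\<^sup>2\<close>, which has the parity of \<open>x\<close>.\<close>

lemma fps_square_cong_2:
  fixes f :: "int fps"
  shows "2 dvd f\<^sup>2 - (f oo fps_X\<^sup>2)"
  unfolding numeral_dvd_fps_iff
proof
  fix n
  have "(f\<^sup>2) $ n = (\<Sum>i\<le>n. f $ i * f $ (n - i))"
    by (simp add: power2_eq_square fps_mult_nth atMost_atLeast0)
  then show "2 dvd (f\<^sup>2 - (f oo fps_X\<^sup>2)) $ n"
    by (simp add: sum_symmetric_pairs fps_nth_compose_X_power)
qed

section \<open>Generating functions of weighted sets\<close>

text \<open>Identities of series become bijections of index sets. An infinite fibre would count as 0
  under \<open>card\<close>, hence the finiteness assumptions for unions and products.\<close>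

definition weight_fps :: "('a \<Rightarrow> nat) \<Rightarrow> 'a set \<Rightarrow> int fps" where
  "weight_fps w A = Abs_fps (\<lambda>n. int (card {x \<in> A. w x = n}))"

lemma weight_fps_nth: "weight_fps w A $ n = int (card {x \<in> A. w x = n})"
  by (simp add: weight_fps_def)

lemma weight_fps_bij:
  assumes "bij_betw h A B" and "\<And>x. x \<in> A \<Longrightarrow> w x = w' (h x)"
  shows "weight_fps w A = weight_fps w' B"
proof (rule fps_ext)
  fix n
  have "bij_betw h {x \<in> A. w x = n} {y \<in> B. w' y = n}"
    using assms by (auto simp: bij_betw_def inj_on_def)
  then show "weight_fps w A $ n = weight_fps w' B $ n"
    by (simp add: weight_fps_nth bij_betw_same_card)
qed

lemma weight_fps_Un:
  assumes "A \<inter> B = {}"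
    and "\<And>n. finite {x \<in> A. w x = n}" and "\<And>n. finite {x \<in> B. w x = n}"
  shows "weight_fps w (A \<union> B) = weight_fps w A + weight_fps w B"
proof (rule fps_ext)
  fix n
  have "{x \<in> A \<union> B. w x = n} = {x \<in> A. w x = n} \<union> {x \<in> B. w x = n}" by auto
  then show "weight_fps w (A \<union> B) $ n = (weight_fps w A + weight_fps w B) $ n"
    using assms by (simp add: weight_fps_nth card_Un_disjoint disjoint_iff)
qed

lemma weight_fps_shift: "weight_fps (\<lambda>x. k + w x) A = fps_X ^ k * weight_fps w A"
proof (rule fps_ext)
  fix n
  have "{x \<in> A. k + w x = n} = (if n < k then {} else {x \<in> A. w x = n - k})" by auto
  then show "weight_fps (\<lambda>x. k + w x) A $ n = (fps_X ^ k * weight_fps w A) $ n"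
    by (simp add: weight_fps_nth fps_X_power_mult_nth)
qed

lemma weight_fps_scale:
  assumes "k > 0"
  shows "weight_fps (\<lambda>x. k * w x) A = weight_fps w A oo fps_X ^ k"
proof (rule fps_ext)
  fix n
  have "{x \<in> A. k * w x = n} = (if k dvd n then {x \<in> A. w x = n div k} else {})"
    using assms by auto
  then show "weight_fps (\<lambda>x. k * w x) A $ n = (weight_fps w A oo fps_X ^ k) $ n"
    using assms by (simp add: weight_fps_nth fps_nth_compose_X_power)
qed

lemma weight_fps_mult:
  assumes "\<And>n. finite {x \<in> A. v x = n}" and "\<And>n. finite {y \<in> B. w y = n}"
  shows "weight_fps v A * weight_fps w B = weight_fps (\<lambda>(x, y). v x + w y) (A \<times> B)"
proof (rule fps_ext)
  fix n
  have "{z \<in> A \<times> B. (case z of (x, y) \<Rightarrow> v x + w y) = n} =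
          (\<Union>i\<in>{0..n}. {x \<in> A. v x = i} \<times> {y \<in> B. w y = n - i})"
    by auto
  also have "card \<dots> = (\<Sum>i=0..n. card ({x \<in> A. v x = i} \<times> {y \<in> B. w y = n - i}))"
    using assms by (intro card_UN_disjoint) auto
  finally show "(weight_fps v A * weight_fps w B) $ n =
      weight_fps (\<lambda>(x, y). v x + w y) (A \<times> B) $ n"
    by (simp add: weight_fps_nth fps_mult_nth card_cartesian_product)
qed

section \<open>A finite form of Gauss' identity\<close>

text \<open>Shanks' finite form of Gauss' identity, multiplied by the denominators
  so that it holds in every commutative ring.\<close>

lemma shanks_identity:
  fixes q :: "'a::comm_ring_1"
  shows "(\<Prod>j=1..n. 1 - q ^ (2 * j - 1)) * (\<Sum>i<2 * n. q ^ triangle i) =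
    (\<Sum>s<n. (\<Prod>j=1..s. 1 - q ^ (2 * j - 1)) * (\<Prod>j=s+1..n. 1 - q ^ (2 * j)) * q ^ (s * (2 * n + 1)))"
proof (induction n)
  case 0
  show ?case by simp
next
  case (Suc n)
  define A where "A s = (\<Prod>j=1..s. 1 - q ^ (2 * j - 1))" for s
  define D where "D m s = A s * (\<Prod>j=s+1..m. 1 - q ^ (2 * j))" for m s
  define Q where "Q = q ^ (2 * n + 1)"
  have A_Suc: "A (Suc s) = A s * (1 - q ^ (2 * s + 1))" for s
    by (simp add: A_def)
  have D_Suc: "D (Suc n) s = D n s * (1 - q * Q)" if "s \<le> n" for s
    using that by (simp add: D_def Q_def)
  have D_step: "D n (Suc s) * (1 - q ^ (2 * Suc s)) = D n s * (1 - q ^ (2 * s + 1))"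
    if "s < n" for s
  proof -
    have "(\<Prod>j=s+1..n. 1 - q ^ (2 * j)) = (1 - q ^ (2 * Suc s)) * (\<Prod>j=Suc s+1..n. 1 - q ^ (2 * j))"
      using that by (simp add: prod.atLeast_Suc_atMost)
    then show ?thesis by (simp add: D_def A_Suc mult_ac)
  qed
  have D_diag: "D n n = A n" by (simp add: D_def)
  have Q_power: "q ^ (s * (2 * n + 1)) = Q ^ s" for s
    unfolding Q_def power_mult [symmetric] by (simp add: mult.commute)
  have IH: "A n * (\<Sum>i<2 * n. q ^ triangle i) = (\<Sum>s<n. D n s * Q ^ s)"
    using Suc.IH by (simp only: A_def D_def Q_power)
  \<comment> \<open>With \<open>G s = D n s * (1 - q ^ (2 * s)) * Q ^ s\<close>,
    \<open>D_step\<close> turns each summand into \<open>G (s + 1) - G s\<close>, and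
    \<open>G 0 = 0\<close>.\<close>
  have telescope: "(\<Sum>s<m. D n s * Q ^ s * (Q * (1 - q ^ (2 * s + 1)) - (1 - q ^ (2 * s)))) =
       D n m * (1 - q ^ (2 * m)) * Q ^ m" if "m \<le> n" for m
    using that
  proof (induction m)
    case 0
    show ?case by simp
  next
    case (Suc m)
    have "D n (Suc m) * (1 - q ^ (2 * Suc m)) * Q ^ Suc m =
        D n m * (1 - q ^ (2 * m + 1)) * Q ^ Suc m"
      using D_step [of m] Suc.prems by simp
    with Suc show ?case
      by (simp only: sum.lessThan_Suc Suc_leD) (simp add: algebra_simps)
  qed
  \<comment> \<open>Both exponents are multiples of \<open>2 * n + 1\<close>, so the two new terms
    of the sum over triangular numbers are powers of \<open>Q\<close>.\<close>
  have tri: "triangle (2 * n) = n * (2 * n + 1)" "triangle (2 * n + 1) = (n + 1) * (2 * n + 1)"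
    by (simp_all add: triangle_def)
  have "A (Suc n) * (\<Sum>i<2 * Suc n. q ^ triangle i) =
      (1 - Q) * (A n * (\<Sum>i<2 * n. q ^ triangle i) + A n * Q ^ n + A n * Q ^ Suc n)"
  proof -
    have "q ^ triangle (2 * n) = Q ^ n" "q ^ triangle (2 * n + 1) = Q ^ Suc n"
      unfolding tri using Q_power [of n] Q_power [of "n + 1"] by simp_all
    then have "(\<Sum>i<2 * Suc n. q ^ triangle i) = (\<Sum>i<2 * n. q ^ triangle i) + Q ^ n + Q ^ Suc n"
      by simp
    then show ?thesis
      by (simp only: A_Suc Q_def [symmetric]) (simp add: algebra_simps)
  qed
  also have "\<dots> = (1 - Q) * (\<Sum>s<Suc n. D n s * Q ^ s) + (1 - Q) * A n * Q ^ Suc n"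
    unfolding IH by (simp add: D_diag algebra_simps)
  \<comment> \<open>Termwise, this sum minus \<open>1 - Q\<close> times the old one is the summand
    of \<open>telescope\<close>; summed over \<open>s <= n\<close> it supplies the stray term
    \<open>(1 - Q) * A n * Q ^ Suc n\<close>.\<close>
  also have "\<dots> = (\<Sum>s<Suc n. D n s * (1 - q * Q) * (q ^ (2 * s) * Q ^ s))"
  proof -
    have "(\<Sum>s<Suc n. D n s * (1 - q * Q) * (q ^ (2 * s) * Q ^ s)) - (1 - Q) * (\<Sum>s<Suc n. D n s * Q ^ s)
      = (\<Sum>s<Suc n. D n s * Q ^ s * (Q * (1 - q ^ (2 * s + 1)) - (1 - q ^ (2 * s))))"
      by (simp only: sum_distrib_left sum_subtractf [symmetric])
         (intro sum.cong refl, simp add: algebra_simps)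
    also have "\<dots> = (1 - Q) * A n * Q ^ Suc n"
      using telescope [of n] by (simp add: D_diag Q_def algebra_simps)
    finally show ?thesis by (simp add: algebra_simps)
  qed
  also have "\<dots> = (\<Sum>s<Suc n. D (Suc n) s * q ^ (s * (2 * Suc n + 1)))"
  proof (intro sum.cong refl)
    fix s assume "s \<in> {..<Suc n}"
    moreover have "s * (2 * Suc n + 1) = 2 * s + s * (2 * n + 1)" by simp
    then have "q ^ (s * (2 * Suc n + 1)) = q ^ (2 * s) * Q ^ s"
      by (simp only: power_add Q_power)
    ultimately show "D n s * (1 - q * Q) * (q ^ (2 * s) * Q ^ s) =
        D (Suc n) s * q ^ (s * (2 * Suc n + 1))"
      by (simp add: D_Suc)
  qed
  finally show ?case by (simp add: A_def D_def)
qed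


section \<open>Partitions with distinct odd parts and their product formula\<close>

definition pods :: "nat multiset set" where
  "pods = {p. is_partition p \<and> odd_parts_distinct p}"

definition pods_upto :: "nat \<Rightarrow> nat multiset set" where
  "pods_upto N = {p \<in> pods. \<forall>i\<in>#p. i \<le> N}"

lemma finite_pods: "finite {p \<in> pods. sum_mset p = n}"
  by (rule finite_subset [OF _ finite_partitions_le [of n]]) (auto simp: pods_def)

lemma finite_pods_upto: "finite {p \<in> pods_upto N. sum_mset p = n}"
  by (rule finite_subset [OF _ finite_pods [of n]]) (auto simp: pods_upto_def)

lemma pods_upto_0: "pods_upto 0 = {{#}}"
  by (auto simp: pods_upto_def pods_def is_partition_def odd_parts_distinct_def
      intro: multiset_nonemptyE)

text \<open>An odd part occurs at most once, so deleting it leaves only parts up to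
  \<open>N\<close>.\<close>

lemma pods_upto_Suc_odd:
  assumes "odd (Suc N)"
  shows "pods_upto (Suc N) = pods_upto N \<union> add_mset (Suc N) ` pods_upto N"
proof (intro equalityI subsetI)
  fix p assume p: "p \<in> pods_upto (Suc N)"
  show "p \<in> pods_upto N \<union> add_mset (Suc N) ` pods_upto N"
  proof (cases "Suc N \<in># p")
    case True
    then obtain p' where p': "p = add_mset (Suc N) p'" by (meson mset_add)
    have "count p (Suc N) \<le> 1"
      using p assms by (auto simp: pods_upto_def pods_def odd_parts_distinct_def)
    then have "Suc N \<notin># p'" by (simp add: p' not_in_iff)
    moreover have "count p' i \<le> 1" if "odd i" for i
    proof -
      have "count p' i \<le> count p i" by (simp add: p')
      also have "\<dots> \<le> 1"
        using p that by (auto simp: pods_upto_def pods_def odd_parts_distinct_def)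
      finally show ?thesis .
    qed
    ultimately have "p' \<in> pods_upto N"
      using p unfolding pods_upto_def pods_def odd_parts_distinct_def is_partition_def p'
      by (auto simp: le_Suc_eq)
    then show ?thesis using p' by auto
  next
    case False
    then show ?thesis using p by (auto simp: pods_upto_def le_Suc_eq)
  qed
next
  fix p assume "p \<in> pods_upto N \<union> add_mset (Suc N) ` pods_upto N"
  then show "p \<in> pods_upto (Suc N)"
  proof
    assume "p \<in> add_mset (Suc N) ` pods_upto N"
    then obtain p' where p': "p = add_mset (Suc N) p'" "p' \<in> pods_upto N" by auto
    then have "Suc N \<notin># p'" by (auto simp: pods_upto_def)
    then show ?thesis
      using p' by (auto simp: pods_upto_def pods_def odd_parts_distinct_def is_partition_def not_in_iff)
  qed (auto simp: pods_upto_def)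
qed

text \<open>An even part may repeat, so deleting one copy stays within the same set; this recursion
  is the source of the denominator \<open>1 - fps_X ^ Suc N\<close>.\<close>

lemma pods_upto_Suc_even:
  assumes "even (Suc N)"
  shows "pods_upto (Suc N) = pods_upto N \<union> add_mset (Suc N) ` pods_upto (Suc N)"
proof (intro equalityI subsetI)
  fix p assume p: "p \<in> pods_upto (Suc N)"
  show "p \<in> pods_upto N \<union> add_mset (Suc N) ` pods_upto (Suc N)"
  proof (cases "Suc N \<in># p")
    case True
    then obtain p' where p': "p = add_mset (Suc N) p'" by (meson mset_add)
    have "p' \<in> pods_upto (Suc N)"
      using p assms unfolding pods_upto_def pods_def odd_parts_distinct_def is_partition_def p'
      by (auto split: if_splits)
    then show ?thesis using p' by auto
  next
    case False
    then show ?thesis using p by (auto simp: pods_upto_def le_Suc_eq)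
  qed
next
  fix p assume "p \<in> pods_upto N \<union> add_mset (Suc N) ` pods_upto (Suc N)"
  then show "p \<in> pods_upto (Suc N)"
    using assms by (auto simp: pods_upto_def pods_def odd_parts_distinct_def is_partition_def)
qed

lemma weight_fps_add_mset:
  "weight_fps sum_mset (add_mset k ` A) = fps_X ^ k * weight_fps sum_mset A"
proof -
  have "weight_fps (\<lambda>p. k + sum_mset p) A = weight_fps sum_mset (add_mset k ` A)"
    by (rule weight_fps_bij [of "add_mset k"]) (auto simp: bij_betw_def inj_on_def)
  then show ?thesis by (simp add: weight_fps_shift)
qed

lemma finite_add_mset_pods_upto:
  "finite {p \<in> add_mset k ` pods_upto N. sum_mset p = n}"
proof (rule finite_subset)
  show "{p \<in> add_mset k ` pods_upto N. sum_mset p = n} \<subseteq>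
      add_mset k ` {p \<in> pods_upto N. sum_mset p = n - k}"
    by auto
qed (simp add: finite_pods_upto)

lemma weight_fps_pods_upto_Suc_odd:
  assumes "odd (Suc N)"
  shows "weight_fps sum_mset (pods_upto (Suc N)) =
    (1 + fps_X ^ Suc N) * weight_fps sum_mset (pods_upto N)"
proof -
  have "pods_upto N \<inter> add_mset (Suc N) ` pods_upto N = {}"
    by (auto simp: pods_upto_def)
  then show ?thesis
    unfolding pods_upto_Suc_odd [OF assms]
    by (subst weight_fps_Un)
       (simp_all add: weight_fps_add_mset finite_pods_upto finite_add_mset_pods_upto algebra_simps)
qed

lemma weight_fps_pods_upto_Suc_even:
  assumes "even (Suc N)"
  shows "(1 - fps_X ^ Suc N) * weight_fps sum_mset (pods_upto (Suc N)) =
    weight_fps sum_mset (pods_upto N)"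
proof -
  have "pods_upto N \<inter> add_mset (Suc N) ` pods_upto (Suc N) = {}"
    by (auto simp: pods_upto_def)
  then have "weight_fps sum_mset (pods_upto (Suc N)) =
    weight_fps sum_mset (pods_upto N) + fps_X ^ Suc N * weight_fps sum_mset (pods_upto (Suc N))"
    by (subst pods_upto_Suc_even [OF assms], subst weight_fps_Un)
       (simp_all add: weight_fps_add_mset finite_pods_upto finite_add_mset_pods_upto)
  then show ?thesis by (simp add: algebra_simps)
qed

text \<open>The finite product formula with denominators cleared; each step admits the odd part
  \<open>2 * n + 1\<close> and the even part \<open>2 * n + 2\<close>.\<close>

lemma weight_fps_pods_upto:
  "weight_fps sum_mset (pods_upto (2 * n)) * (\<Prod>j=1..n. 1 - fps_X ^ (2 * j)) =
    (\<Prod>j=1..n. 1 + fps_X ^ (2 * j - 1))"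
proof (induction n)
  case 0
  have "{x::nat multiset. x = {#} \<and> sum_mset x = n} = (if n = 0 then {{#}} else {})" for n
    by auto
  then show ?case
    by (auto simp: pods_upto_0 fps_eq_iff weight_fps_nth)
next
  case (Suc n)
  let ?W = "\<lambda>N. weight_fps sum_mset (pods_upto N)"
  have "?W (2 * Suc n) * (\<Prod>j=1..Suc n. 1 - fps_X ^ (2 * j)) =
      ((1 - fps_X ^ Suc (Suc (2 * n))) * ?W (Suc (Suc (2 * n)))) * (\<Prod>j=1..n. 1 - fps_X ^ (2 * j))"
    by (simp add: mult_ac)
  also have "\<dots> = (1 + fps_X ^ Suc (2 * n)) * (?W (2 * n) * (\<Prod>j=1..n. 1 - fps_X ^ (2 * j)))"
    by (subst weight_fps_pods_upto_Suc_even, simp, subst weight_fps_pods_upto_Suc_odd)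
       (simp_all only: even_Suc even_mult_iff even_numeral simp_thms mult_ac)
  also have "\<dots> = (\<Prod>j=1..Suc n. 1 + fps_X ^ (2 * j - 1))"
    unfolding Suc.IH by (simp add: mult.commute)
  finally show ?case .
qed

text \<open>Congruence modulo every power of X stands in for limits: a series divisible by all of
  them is 0.\<close>

lemma fps_X_power_dvd_iff:
  fixes f :: "'a::comm_ring_1 fps"
  shows "fps_X ^ n dvd f \<longleftrightarrow> (\<forall>i<n. f $ i = 0)"
proof
  assume "fps_X ^ n dvd f"
  then obtain g where "f = fps_X ^ n * g" ..
  then show "\<forall>i<n. f $ i = 0" by (simp add: fps_X_power_mult_nth)
next
  assume "\<forall>i<n. f $ i = 0"
  then have "f = fps_X ^ n * fps_shift n f"
    by (simp add: fps_eq_iff fps_X_power_mult_nth)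
  then show "fps_X ^ n dvd f" ..
qed

lemma weight_fps_pods_trunc:
  "fps_X ^ n dvd weight_fps sum_mset pods - weight_fps sum_mset (pods_upto n)"
  unfolding fps_X_power_dvd_iff
proof (intro allI impI)
  fix k assume "k < n"
  have "i \<le> sum_mset p" if "i \<in># p" for i :: nat and p
    using that by (metis sum_mset.remove le_add1)
  with \<open>k < n\<close> have "{p \<in> pods_upto n. sum_mset p = k} = {p \<in> pods. sum_mset p = k}"
    by (fastforce simp: pods_upto_def)
  then show "(weight_fps sum_mset pods - weight_fps sum_mset (pods_upto n)) $ k = 0"
    by (simp add: weight_fps_nth)
qed

text \<open>Splitting off the head of a list turns tuples into pairs, hence into a product of
  series.\<close>

lemma pod_neg_conv_weight_fps: "int (pod_neg k n) = (weight_fps sum_mset pods ^ k) $ n"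
proof -
  define L where "L k = {ps. length ps = k \<and> set ps \<subseteq> pods}" for k
  define W where "W = (\<lambda>ps :: nat multiset list. \<Sum>p\<leftarrow>ps. sum_mset p)"
  have L: "pod_tuples k n = {ps \<in> L k. W ps = n}" for k n
    by (auto simp: pod_tuples_def L_def pods_def W_def)
  have "weight_fps W (L k) = weight_fps sum_mset pods ^ k"
  proof (induction k)
    case 0
    have "{ps \<in> L 0. W ps = n} = (if n = 0 then {[]} else {})" for n
      by (auto simp: L_def W_def)
    then show ?case by (auto simp: fps_eq_iff weight_fps_nth)
  next
    case (Suc k)
    have "weight_fps sum_mset pods ^ Suc k = weight_fps sum_mset pods * weight_fps W (L k)"
      by (simp add: Suc)
    also have "\<dots> = weight_fps (\<lambda>(p, ps). sum_mset p + W ps) (pods \<times> L k)"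
      by (rule weight_fps_mult) (simp_all add: finite_pods L [symmetric] finite_pod_tuples)
    also have "\<dots> = weight_fps W (L (Suc k))"
      by (rule weight_fps_bij [of "\<lambda>(p, ps). p # ps"])
         (auto simp: bij_betw_def inj_on_def L_def W_def image_iff length_Suc_conv)
    finally show ?case ..
  qed
  then show ?thesis
    by (simp add: pod_neg_def L weight_fps_nth [symmetric])
qed

section \<open>Gauss' identity for the theta series psi\<close>

definition psi :: "int fps" where
  "psi = weight_fps triangle UNIV"

lemma triangle_ge: "n \<le> triangle n"
  by (induction n) auto

lemma strict_mono_triangle: "strict_mono triangle"
  by (simp add: strict_mono_Suc_iff)

lemma triangle_eq_iff [simp]: "triangle m = triangle n \<longleftrightarrow> m = n"
  using strict_mono_triangle by (rule strict_mono_eq)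

lemma finite_triangle: "finite {i. triangle i = n}"
  by (rule finite_subset [of _ "{..n}"]) (use triangle_ge in auto)

lemma psi_nth_triangle: "psi $ triangle k = 1"
  by (simp add: psi_def weight_fps_nth)

lemma psi_nth_eq_0: "\<nexists>k. n = triangle k \<Longrightarrow> psi $ n = 0"
  by (simp add: psi_def weight_fps_nth eq_commute [of "triangle _"])

text \<open>Since \<open>i <= triangle i\<close>, terms with \<open>i >= n\<close> only reach
  exponents from \<open>n\<close> on.\<close>

lemma psi_uminus_trunc:
  "fps_X ^ n dvd (psi oo - fps_X) - (\<Sum>i<n. (- fps_X) ^ triangle i)"
  unfolding fps_X_power_dvd_iff
proof (intro allI impI)
  fix k assume "k < n"
  have *: "(- fps_X :: int fps) ^ m = fps_const ((- 1) ^ m) * fps_X ^ m" for m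
    by (subst power_minus) (simp add: fps_const_power [symmetric] fps_const_neg [symmetric]
       del: fps_const_neg fps_const_power)
  have "{i. triangle i = k} = {i \<in> {..<n}. triangle i = k}"
    using triangle_ge \<open>k < n\<close> by (auto intro: le_less_trans)
  then have "(psi oo - fps_X) $ k = (\<Sum>i\<in>{i \<in> {..<n}. triangle i = k}. (- 1) ^ k)"
    by (simp add: fps_compose_uminus' psi_def weight_fps_nth)
  also have "\<dots> = (\<Sum>i<n. if k = triangle i then (- 1) ^ triangle i else 0)"
    unfolding sum.inter_filter [OF finite_lessThan] by (intro sum.cong) auto
  also have "\<dots> = (\<Sum>i<n. (- fps_X) ^ triangle i) $ k"
    by (simp add: fps_sum_nth * if_distrib cong: if_cong)
  finally show "((psi oo - fps_X) - (\<Sum>i<n. (- fps_X) ^ triangle i)) $ k = 0"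
    by simp
qed

text \<open>The difference of the two sides is divisible by every \<open>fps_X ^ n\<close>: the
  finite product formula and Shanks' identity show this up to the factor \<open>A\<close>, which is
  invertible.\<close>

lemma pods_mult_psi: "weight_fps sum_mset pods * (psi oo - fps_X) = 1"
proof -
  let ?P = "weight_fps sum_mset pods" and ?R = "psi oo - fps_X"
  have "fps_X ^ n dvd ?P * ?R - 1" for n
  proof -
    define A B where "A = (\<Prod>j=1..n. 1 + fps_X ^ (2 * j - 1) :: int fps)"
      and "B = (\<Prod>j=1..n. 1 - fps_X ^ (2 * j) :: int fps)"
    define T where "T = (\<Sum>i<2 * n. (- fps_X) ^ triangle i :: int fps)"
    define Z where "Z = weight_fps sum_mset (pods_upto (2 * n))"
    have X_dvd: "fps_X ^ n dvd f" if "fps_X ^ (2 * n) dvd f" for f :: "int fps"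
      using that by (rule power_le_dvd) simp
    \<comment> \<open>Odd exponents turn minus into plus, so at \<open>- fps_X\<close> the odd
      product of Shanks' identity is \<open>A\<close>.\<close>
    have "A = (\<Prod>j=1..n. 1 - (- fps_X) ^ (2 * j - 1))"
      unfolding A_def by (intro prod.cong) auto
    moreover have "(- fps_X :: int fps) ^ (2 * j) = fps_X ^ (2 * j)" for j
      by simp
    ultimately have "A * T = (\<Sum>s<n. (\<Prod>j=1..s. 1 - (- fps_X) ^ (2 * j - 1)) *
        (\<Prod>j=s+1..n. 1 - fps_X ^ (2 * j)) * (- fps_X) ^ (s * (2 * n + 1)))"
      using shanks_identity [of "- fps_X :: int fps" n] unfolding T_def by simp
    \<comment> \<open>The summand \<open>s = 0\<close> is exactly \<open>B\<close>; every other one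
      carries a power of X with exponent at least \<open>2 * n + 1\<close>.\<close>
    also have "fps_X ^ n dvd \<dots> - B"
    proof (cases n)
      case (Suc m)
      have "fps_X ^ n dvd (- fps_X :: int fps) ^ (Suc s * (2 * n + 1))" for s
      proof -
        have "(- fps_X :: int fps) ^ n dvd (- fps_X) ^ (Suc s * (2 * n + 1))"
          by (rule le_imp_power_dvd) simp
        then show ?thesis by (metis minus_dvd_iff power_minus_even power_minus_odd)
      qed
      then show ?thesis
        unfolding B_def Suc sum.lessThan_Suc_shift
        by (simp del: mult_Suc add: dvd_sum)
    qed simp
    finally have "fps_X ^ n dvd A * T - B" .
    moreover have "fps_X ^ n dvd ?R - T"
      unfolding T_def using psi_uminus_trunc by (rule X_dvd)
    moreover have "fps_X ^ n dvd ?P - Z"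
      unfolding Z_def using weight_fps_pods_trunc by (rule X_dvd)
    \<comment> \<open>By \<open>Z * B = A\<close>, this combination of the three truncation errors
      collapses to \<open>A * (?P * ?R - 1)\<close>.\<close>
    ultimately have "fps_X ^ n dvd ?P * (A * T - B) + ?P * A * (?R - T) + (?P - Z) * B"
      by (intro dvd_add) auto
    also have "\<dots> = A * (?P * ?R - 1)"
      using weight_fps_pods_upto [of n, folded A_def B_def Z_def] by (simp add: algebra_simps)
    finally have "fps_X ^ n dvd A * (?P * ?R - 1)" .
    moreover have "A $ 0 = 1"
    proof -
      have "(\<Prod>j=1..m. 1 + fps_X ^ (2 * j - 1) :: int fps) $ 0 = 1" for m
        by (induction m) auto
      then show ?thesis by (simp add: A_def)
    qed
    then have "A * fps_right_inverse A 1 = 1" by (intro fps_right_inverse) simp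
    then have "?P * ?R - 1 = A * (?P * ?R - 1) * fps_right_inverse A 1"
      by (simp add: mult_ac)
    ultimately show ?thesis by (metis dvd_mult2)
  qed
  then have "(?P * ?R - 1) $ i = 0" for i
    unfolding fps_X_power_dvd_iff by blast
  then have "?P * ?R - 1 = 0" by (simp add: fps_eq_iff)
  then show ?thesis by simp
qed

section \<open>The square of psi and the dissection of the squares by parity\<close>

definition squares :: "int fps" where
  "squares = weight_fps (\<lambda>m. m\<^sup>2) {1..}"

lemma finite_square_eq: "finite {m \<in> A. (m::nat)\<^sup>2 = n}"
  by (rule finite_subset [of _ "{..n}"]) (auto simp: power2_eq_square intro: order_trans [OF le_square])

lemma two_triangle: "2 * triangle n = n * (n + 1)"
  by (simp add: triangle_def)

text \<open>Both lattices describe \<open>(a + b + 1)\<^sup>2 + (b - a)\<^sup>2 = (2 m)\<^sup>2 + (2 c + 1)\<^sup>2\<close>;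
  the case distinction says which of the two left-hand squares is the even one.\<close>

lemma triangle_pairs:
  "weight_fps (\<lambda>(a, b). triangle a + triangle b) {(a, b). a < b} =
    weight_fps (\<lambda>(m, c). m\<^sup>2 + 2 * triangle c) ({1..} \<times> UNIV)"
proof (rule sym, rule weight_fps_bij)
  let ?f = "\<lambda>(m, c :: nat). (if m \<le> c then c - m else m - c - 1, m + c)"
  let ?g = "\<lambda>(a, b :: nat). if even (b - a) then ((b - a) div 2, (a + b) div 2)
    else ((a + b + 1) div 2, (b - a) div 2)"
  have gf: "?g (?f (m, c)) = (m, c)" for m c
  proof (cases "m \<le> c")
    case True
    then obtain d where "c = m + d" using le_Suc_ex by blast
    then have "?f (m, c) = (d, d + 2 * m)" and "c = d + m" by simp_all
    then show ?thesis by (simp only:) simp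
  next
    case False
    then obtain d where "m = Suc (c + d)" using less_imp_Suc_add not_le by blast
    then have "?f (m, c) = (d, d + (2 * c + 1))" and "m = d + c + 1" by simp_all
    then show ?thesis by (simp only:) simp
  qed
  have fg: "?f (?g (a, b)) = (a, b) \<and> fst (?g (a, b)) \<ge> 1" if "a < b" for a b
  proof -
    obtain e where e: "b = a + e" "e > 0" using less_imp_add_positive [OF \<open>a < b\<close>] by auto
    show ?thesis
    proof (cases "even e")
      case True
      then obtain m where "e = 2 * m" ..
      with e have "b = a + 2 * m" "m > 0" by simp_all
      moreover from this have "?g (a, b) = (m, a + m)" by simp
      ultimately show ?thesis by simp
    next
      case False
      then obtain c where "e = 2 * c + 1" ..
      with e have "b = a + (2 * c + 1)" by simp
      moreover from this have "?g (a, b) = (a + c + 1, c)" by simp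
      ultimately show ?thesis by simp
    qed
  qed
  show "bij_betw ?f ({1..} \<times> UNIV) {(a, b). a < b}"
  proof (rule bij_betw_byWitness [of _ ?g])
    show "\<forall>x\<in>{1..} \<times> UNIV. ?g (?f x) = x" using gf by blast
    show "\<forall>x\<in>{(a, b). a < b}. ?f (?g x) = x" using fg by blast
    show "?f ` ({1..} \<times> UNIV) \<subseteq> {(a, b). a < b}" by auto
    show "?g ` {(a, b). a < b} \<subseteq> {1..} \<times> UNIV"
    proof
      fix y assume "y \<in> ?g ` {(a, b). a < b}"
      then obtain a b where "a < b" and y: "y = ?g (a, b)" by blast
      then have "1 \<le> fst y" using fg [of a b] unfolding y by blast
      then show "y \<in> {1..} \<times> UNIV" by (simp add: mem_Times_iff)
    qed
  qed
next
  fix x :: "nat \<times> nat" assume x: "x \<in> {1..} \<times> UNIV"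
  obtain m c where mc: "x = (m, c)" by force
  have "triangle (c - m) + triangle (m + c) = m\<^sup>2 + 2 * triangle c" if "m \<le> c"
  proof -
    obtain d where "c = m + d" using \<open>m \<le> c\<close> le_Suc_ex by blast
    \<comment> \<open>Doubling removes the division by 2 in \<open>triangle\<close> and leaves a
      polynomial identity in \<open>m\<close> and \<open>d\<close>.\<close>
    then have "2 * triangle (c - m) + 2 * triangle (m + c) = 2 * (m\<^sup>2 + 2 * triangle c)"
      unfolding distrib_left two_triangle by (simp add: algebra_simps power2_eq_square)
    then show ?thesis by simp
  qed
  moreover have "triangle (m - c - 1) + triangle (m + c) = m\<^sup>2 + 2 * triangle c" if "c < m"
  proof -
    obtain d where "m = c + d + 1" using less_imp_Suc_add [OF \<open>c < m\<close>] by auto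
    then have "2 * triangle (m - c - 1) + 2 * triangle (m + c) = 2 * (m\<^sup>2 + 2 * triangle c)"
      unfolding distrib_left two_triangle by (simp add: algebra_simps power2_eq_square)
    then show ?thesis by simp
  qed
  ultimately show "(case x of (m, c) \<Rightarrow> m\<^sup>2 + 2 * triangle c) =
    (case case x of (m, c) \<Rightarrow> (if m \<le> c then c - m else m - c - 1, m + c) of
       (a, b) \<Rightarrow> triangle a + triangle b)"
    by (auto simp: mc not_le)
qed

text \<open>Pairs are split by \<open>a < b\<close>, \<open>b < a\<close> and \<open>a = b\<close>.
  The first two classes agree by swapping, and \<open>triangle_pairs\<close> evaluates them; the
  diagonal gives \<open>psi oo fps_X\<^sup>2\<close>.\<close>

lemma psi_square: "psi\<^sup>2 = (psi oo fps_X\<^sup>2) * (1 + 2 * squares)"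
proof -
  let ?w = "\<lambda>(a, b). triangle a + triangle b"
  have fin: "finite {x. Q x \<and> ?w x = n}" for Q n
  proof (rule finite_subset)
    show "{x. Q x \<and> ?w x = n} \<subseteq> {..n} \<times> {..n}"
      by (auto intro: trans_le_add1 trans_le_add2 triangle_ge)
  qed simp
  have UNIV: "UNIV \<times> UNIV = {(a, b). a < b} \<union> {(a, b). b < a} \<union> {(a, b). a = (b :: nat)}"
    by auto
  have "psi\<^sup>2 = weight_fps ?w (UNIV \<times> UNIV)"
    unfolding psi_def power2_eq_square by (rule weight_fps_mult) (simp_all add: finite_triangle)
  also have "\<dots> = weight_fps ?w {(a, b). a < b} + weight_fps ?w {(a, b). b < a} +
      weight_fps ?w {(a, b). a = b}"
    unfolding UNIV by (subst weight_fps_Un, auto simp: fin)+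
  also have "weight_fps ?w {(a, b). b < a} = weight_fps ?w {(a, b). a < b}"
    by (rule weight_fps_bij [of prod.swap]) (auto simp: bij_betw_def inj_on_def image_iff)
  also have "weight_fps ?w {(a, b). a < b} =
      weight_fps (\<lambda>(m, c). m\<^sup>2 + 2 * triangle c) ({1..} \<times> UNIV)"
    by (rule triangle_pairs)
  also have "\<dots> = squares * weight_fps (\<lambda>c. 2 * triangle c) UNIV"
    unfolding squares_def
  proof (rule weight_fps_mult [symmetric])
    show "finite {y \<in> UNIV. 2 * triangle y = n}" for n
      by (rule finite_subset [OF _ finite_triangle [of "n div 2"]]) auto
  qed (rule finite_square_eq)
  also have "weight_fps ?w {(a, b). a = b} = weight_fps (\<lambda>c. 2 * triangle c) UNIV"
    by (rule weight_fps_bij [of fst]) (auto simp: bij_betw_def inj_on_def image_iff)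
  also have "weight_fps (\<lambda>c. 2 * triangle c) UNIV = psi oo fps_X\<^sup>2"
    by (simp add: weight_fps_scale psi_def)
  finally show ?thesis by (simp add: algebra_simps)
qed

text \<open>Even \<open>m = 2 * k\<close> have square \<open>4 * k\<^sup>2\<close>, odd
  \<open>m = 2 * c + 1\<close> have square \<open>8 * triangle c + 1\<close>.\<close>

lemma squares_split: "squares = (squares oo fps_X ^ 4) + fps_X * (psi oo fps_X ^ 8)"
proof -
  have "{1..} = {m. 1 \<le> m \<and> even m} \<union> {m :: nat. odd m}"
    by (auto elim: oddE)
  then have "squares = weight_fps (\<lambda>m. m\<^sup>2) {m. 1 \<le> m \<and> even m} + weight_fps (\<lambda>m. m\<^sup>2) {m. odd m}"
    unfolding squares_def by (simp only:) (subst weight_fps_Un; (rule finite_square_eq)?; auto)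
  also have "weight_fps (\<lambda>m. m\<^sup>2) {m. 1 \<le> m \<and> even m} = weight_fps (\<lambda>m. 4 * m\<^sup>2) {1..}"
    by (rule weight_fps_bij [of "\<lambda>m. m div 2"])
       (auto simp: power2_eq_square elim!: evenE intro!: bij_betw_byWitness [of _ "\<lambda>m. 2 * m"])
  also have "\<dots> = squares oo fps_X ^ 4"
    by (simp add: weight_fps_scale squares_def)
  also have "weight_fps (\<lambda>m. m\<^sup>2) {m. odd m} = weight_fps (\<lambda>c. 1 + 8 * triangle c) UNIV"
  proof (rule weight_fps_bij [of "\<lambda>m. m div 2"])
    show "bij_betw (\<lambda>m. m div 2) {m. odd m} (UNIV :: nat set)"
      by (rule bij_betw_byWitness [of _ "\<lambda>m. 2 * m + 1"]) (auto elim: oddE)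
  next
    fix m :: nat assume "m \<in> {m. odd m}"
    then obtain c where m: "m = 2 * c + 1" by (auto elim: oddE)
    have "1 + 8 * triangle c = 1 + 4 * (2 * triangle c)" by simp
    also have "\<dots> = m\<^sup>2" unfolding two_triangle m by (simp add: power2_eq_square algebra_simps)
    finally show "m\<^sup>2 = 1 + 8 * triangle (m div 2)" by (simp add: m)
  qed
  also have "\<dots> = fps_X * (psi oo fps_X ^ 8)"
    by (subst weight_fps_shift) (simp add: weight_fps_scale psi_def)
  finally show ?thesis .
qed

section \<open>Congruences for the generating function modulo 2 and 8\<close>

text \<open>\<open>g\<close> and \<open>h\<close> stay unspecified because only supports matter:
  multiples of 4 for \<open>g oo fps_X ^ 4\<close>, even exponents for
  \<open>h oo fps_X\<^sup>2\<close>.\<close>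

lemma pod_4_fps_cong:
  defines "F \<equiv> weight_fps sum_mset pods ^ 4"
  obtains g h where "2 dvd F - (g oo fps_X ^ 4)"
    and "8 dvd F - ((h oo fps_X\<^sup>2) + 4 * fps_X * (psi oo fps_X ^ 4))"
proof -
  define p2 p4 p8 where "p2 = psi oo fps_X\<^sup>2" and "p4 = psi oo fps_X ^ 4" and "p8 = psi oo fps_X ^ 8"
  define S S2 S4 where "S = squares" and "S2 = squares oo fps_X\<^sup>2" and "S4 = squares oo fps_X ^ 4"
  have X_comp: "(fps_X\<^sup>2 oo fps_X\<^sup>2 :: int fps) = fps_X ^ 4" "(fps_X\<^sup>2 oo fps_X ^ 4 :: int fps) = fps_X ^ 8"
    by (simp_all add: fps_X_power_compose power_mult [symmetric])
  obtain B where B: "psi\<^sup>2 = p2 + 2 * B"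
    using fps_square_cong_2 [of psi] unfolding p2_def dvd_def by (auto simp: algebra_simps)
  \<comment> \<open>Substituting the second and fourth power of X carries the congruence for
    \<open>psi\<^sup>2\<close> over to \<open>p2\<^sup>2\<close> and
    \<open>p4\<^sup>2\<close>.\<close>
  have "psi\<^sup>2 oo c = (p2 oo c) + 2 * (B oo c)" if "c $ 0 = 0" for c :: "int fps"
    using that by (simp add: B fps_compose_add_distrib fps_compose_mult_distrib)
  from this [of "fps_X\<^sup>2"] this [of "fps_X ^ 4"]
  obtain B2 B4 where B2: "p2\<^sup>2 = p4 + 2 * B2" and B4: "p4\<^sup>2 = p8 + 2 * B4"
    by (simp add: p2_def p4_def p8_def fps_compose_power fps_compose_assoc [symmetric] X_comp)
  obtain C where C: "S\<^sup>2 = S2 + 2 * C"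
    using fps_square_cong_2 [of S] unfolding S2_def S_def dvd_def by (auto simp: algebra_simps)
  have S: "S = S4 + fps_X * p8"
    unfolding S_def S4_def p8_def by (rule squares_split)
  have psi_sq: "psi\<^sup>2 = p2 * (1 + 2 * S)"
    unfolding p2_def S_def by (rule psi_square)
  define r where "r = fps_right_inverse psi 1"
  have r: "psi * r = 1"
    unfolding r_def by (rule fps_right_inverse) (use psi_nth_triangle [of 0] in simp)
  define r2 r4 where "r2 = r oo fps_X\<^sup>2" and "r4 = r oo fps_X ^ 4"
  have r2: "p2 * r2 = 1" and r4: "p4 * r4 = 1"
    unfolding p2_def p4_def r2_def r4_def
    by (simp_all add: fps_compose_mult_distrib [symmetric] r)
  define R where "R = psi oo - fps_X"
  have FR: "F * R ^ 4 = 1"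
    unfolding F_def R_def power_mult_distrib [symmetric] pods_mult_psi by simp
  have "2 dvd R - psi"
    unfolding R_def numeral_dvd_fps_iff fps_compose_uminus' by simp
  then obtain A where A: "R = psi + 2 * A" unfolding dvd_def by (auto simp: algebra_simps)
  \<comment> \<open>The binomial terms carry the factors \<open>4 * 2\<close>, \<open>6 * 4\<close>,
    \<open>4 * 8\<close> and \<open>16\<close>, all multiples of 8.\<close>
  have R4: "R ^ 4 = psi ^ 4 + 8 * (psi ^ 3 * A + 3 * psi\<^sup>2 * A\<^sup>2 + 4 * psi * A ^ 3 + 2 * A ^ 4)"
    unfolding A by algebra
  have psi4: "psi ^ 4 = p4 + 2 * (B2 + 2 * B * p2 + 2 * B\<^sup>2)"
    using B B2 by algebra
  have "2 dvd F - r4"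
  proof -
    \<comment> \<open>Chosen so that \<open>R ^ 4 = p4 + 2 * Y\<close>; multiplying
      \<open>F * R ^ 4 = 1\<close> by \<open>r4\<close> then isolates \<open>F\<close>.\<close>
    define Y where "Y = B2 + 2 * B * p2 + 2 * B\<^sup>2 +
      4 * (psi ^ 3 * A + 3 * psi\<^sup>2 * A\<^sup>2 + 4 * psi * A ^ 3 + 2 * A ^ 4)"
    have "F * (p4 + 2 * Y) = 1"
      using FR unfolding R4 psi4 Y_def by (simp add: algebra_simps)
    then have "F - r4 = 2 * (- F * Y * r4)"
      using r4 by algebra
    then show ?thesis ..
  qed
  \<comment> \<open>The witness for \<open>h\<close> collects even exponents: \<open>4 * S\<close>
    is \<open>4 * S4 + 4 * fps_X * p8\<close>, and \<open>4 * S\<^sup>2\<close> is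
    \<open>4 * S2\<close> modulo 8.\<close>
  moreover have "8 dvd F - ((((r\<^sup>2 * (1 + 4 * (squares oo fps_X\<^sup>2) + 4 * squares)) oo fps_X\<^sup>2)) + 4 * fps_X * p4)"
  proof -
    have comp: "((r\<^sup>2 * (1 + 4 * (squares oo fps_X\<^sup>2) + 4 * squares)) oo fps_X\<^sup>2) = r2\<^sup>2 * (1 + 4 * S4 + 4 * S2)"
      by (simp add: fps_compose_mult_distrib fps_compose_add_distrib fps_compose_power
          fps_compose_assoc [symmetric] X_comp r2_def S4_def S2_def)
    define Y where "Y = psi ^ 3 * A + 3 * psi\<^sup>2 * A\<^sup>2 + 4 * psi * A ^ 3 + 2 * A ^ 4"
    \<comment> \<open>This is \<open>(1 + 2 * S)\<^sup>2\<close>, so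
      \<open>psi ^ 4 = p2\<^sup>2 * u\<close>; its square is 1 modulo 8, so \<open>u\<close> serves
      as its own inverse.\<close>
    define u where "u = 1 + 4 * S + 4 * S\<^sup>2"
    have "F * (p2\<^sup>2 * u + 8 * Y) = 1"
      using FR psi_sq unfolding R4 Y_def u_def by algebra
    moreover have "u\<^sup>2 = 1 + 8 * (S + 3 * S\<^sup>2 + 4 * S ^ 3 + 2 * S ^ 4)"
      unfolding u_def by algebra
    ultimately have "8 dvd F - r2\<^sup>2 * u"
    proof -
      assume 1: "F * (p2\<^sup>2 * u + 8 * Y) = 1"
        and 2: "u\<^sup>2 = 1 + 8 * (S + 3 * S\<^sup>2 + 4 * S ^ 3 + 2 * S ^ 4)"
      have "F * (p2 * r2)\<^sup>2 * u\<^sup>2 + 8 * F * Y * r2\<^sup>2 * u = r2\<^sup>2 * u"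
        using 1 by algebra
      then have "F - r2\<^sup>2 * u = 8 * (- F * (S + 3 * S\<^sup>2 + 4 * S ^ 3 + 2 * S ^ 4) - F * Y * r2\<^sup>2 * u)"
        unfolding r2 2 by (simp add: algebra_simps)
      then show ?thesis ..
    qed
    moreover have "8 dvd r2\<^sup>2 * u - (r2\<^sup>2 * (1 + 4 * S4 + 4 * S2) + 4 * fps_X * p4)"
    proof -
      \<comment> \<open>Modulo 2, \<open>p8\<close> is \<open>p4\<^sup>2\<close> and
        \<open>p4\<close> is \<open>p2\<^sup>2\<close>, while \<open>r2\<close> inverts
        \<open>p2\<close>.\<close>
      have "r2\<^sup>2 * p8 = p4 + 2 * (- r2\<^sup>2 * B4 - r2\<^sup>2 * p4 * B2)"
        using B2 B4 r2 by algebra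
      then have "r2\<^sup>2 * u - (r2\<^sup>2 * (1 + 4 * S4 + 4 * S2) + 4 * fps_X * p4) =
          8 * (r2\<^sup>2 * C + fps_X * (- r2\<^sup>2 * B4 - r2\<^sup>2 * p4 * B2))"
        using S C unfolding u_def by algebra
      then show ?thesis ..
    qed
    ultimately have "8 dvd (F - r2\<^sup>2 * u) + (r2\<^sup>2 * u - (r2\<^sup>2 * (1 + 4 * S4 + 4 * S2) + 4 * fps_X * p4))"
      by (rule dvd_add)
    then show ?thesis unfolding comp by (simp only: diff_add_cancel add_diff_eq)
  qed
  ultimately show ?thesis
    using that unfolding r4_def p4_def by blast
qed

section \<open>Reading off the coefficients\<close>

text \<open>\<open>k\<close> and \<open>- k - 1\<close> give the same product, so a negative
  \<open>k\<close> can be traded for a natural number.\<close>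

lemma ex_int_eq_mult_succ_iff: "(\<exists>k::int. int n = k * (k + 1)) \<longleftrightarrow> (\<exists>j. n = 2 * triangle j)"
proof
  assume "\<exists>k::int. int n = k * (k + 1)"
  then obtain k :: int where k: "int n = k * (k + 1)" ..
  define j where "j = nat (if k \<ge> 0 then k else - k - 1)"
  have "int n = int (j * (j + 1))"
    using k by (auto simp: j_def algebra_simps)
  then show "\<exists>j. n = 2 * triangle j"
    unfolding two_triangle of_nat_eq_iff ..
next
  assume "\<exists>j. n = 2 * triangle j"
  then obtain j where "n = j * (j + 1)" unfolding two_triangle ..
  then have "int n = int j * (int j + 1)" by (simp add: algebra_simps)
  then show "\<exists>k::int. int n = k * (k + 1)" ..
qed

theorem theorem4p2:
  fixes n :: nat
  shows "[pod_neg 4 (4 * n + 2) = 0] (mod 2) \<and>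
    ((\<exists>k::int. int n = k * (k + 1)) \<longrightarrow> [pod_neg 4 (2 * n + 1) = 4] (mod 8)) \<and>
    (\<not> (\<exists>k::int. int n = k * (k + 1)) \<longrightarrow> [pod_neg 4 (2 * n + 1) = 0] (mod 8))"
proof -
  obtain g h where g: "2 dvd weight_fps sum_mset pods ^ 4 - (g oo fps_X ^ 4)"
    and h: "8 dvd weight_fps sum_mset pods ^ 4 - ((h oo fps_X\<^sup>2) + 4 * fps_X * (psi oo fps_X ^ 4))"
    by (rule pod_4_fps_cong)
  have "\<not> 4 dvd 4 * n + 2" by presburger
  then have "2 dvd int (pod_neg 4 (4 * n + 2))"
    using g unfolding numeral_dvd_fps_iff
    by (auto simp: pod_neg_conv_weight_fps fps_nth_compose_X_power dest: spec [of _ "4 * n + 2"])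
  then have 1: "[pod_neg 4 (4 * n + 2) = 0] (mod 2)"
    by (simp add: cong_0_iff)
  have "(4 * fps_X * (psi oo fps_X ^ 4)) $ (2 * n + 1) = 4 * (psi oo fps_X ^ 4) $ (2 * n)"
    by (simp add: numeral_fps_const mult.assoc)
  \<comment> \<open>For odd \<open>n\<close> the exponent is not a multiple of 4; for even
    \<open>n\<close> the question is whether \<open>n div 2\<close> is triangular.\<close>
  also have "(psi oo fps_X ^ 4) $ (2 * n) = (if \<exists>j. n = 2 * triangle j then 1 else 0)"
  proof (cases "\<exists>j. n = 2 * triangle j")
    case True
    then show ?thesis by (auto simp: fps_nth_compose_X_power psi_nth_triangle)
  next
    case False
    then have "psi $ (2 * n div 4) = 0" if "4 dvd 2 * n"
      using that by (intro psi_nth_eq_0) auto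
    with False show ?thesis by (simp add: fps_nth_compose_X_power)
  qed
  \<comment> \<open>The exponent is odd, so \<open>h oo fps_X\<^sup>2\<close> contributes
    nothing.\<close>
  finally have "8 dvd int (pod_neg 4 (2 * n + 1)) - int (if \<exists>j. n = 2 * triangle j then 4 else 0)"
    using h unfolding numeral_dvd_fps_iff
    by (auto simp: pod_neg_conv_weight_fps fps_nth_compose_X_power dest: spec [of _ "2 * n + 1"])
  then have "[int (pod_neg 4 (2 * n + 1)) = int (if \<exists>j. n = 2 * triangle j then 4 else 0)] (mod int 8)"
    by (simp add: cong_iff_dvd_diff)
  then have "[pod_neg 4 (2 * n + 1) = (if \<exists>j. n = 2 * triangle j then 4 else 0)] (mod 8)"
    by (simp only: cong_int_iff)
  with 1 show ?thesis unfolding ex_int_eq_mult_succ_iff by (simp split: if_splits)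
qed

end
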